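(* Let $c>0$ and let $G$ be an $n$-vertex circle graph with $\alpha(G)=cn$, where $n$ is sufficiently large. Then $h(G)\le \frac{4n\log\log n}{\log n}$.
   Context: $\log$ is base $2$. A circle graph has as vertices a finite set of chords of a circle, two adjacent iff the chords cross. $\alpha(G)$ is the independence number. A hitting set of $G$ is a set $T\subseteq V(G)$ meeting every maximum independent set of $G$; $h(G)$ is the minimum size of a hitting set. *)

theory Defs
  imports "HOL-Analysis.Analysis" "Graph_Theory.Pair_Digraph"
begin

(* A chord is the closed segment between two distinct points of the circle, as a point set. *)
definition chords :: "complex \<Rightarrow> real \<Rightarrow> complex set set" where
  "chords z r = {closed_segment a b | a b. a \<in> sphere z r \<and> b \<in> sphere z r \<and> a \<noteq> b}"

(* Chords that only share an endpoint on the circle do not cross. *)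
definition cross :: "complex \<Rightarrow> real \<Rightarrow> complex set \<Rightarrow> complex set \<Rightarrow> bool" where
  "cross z r S T \<longleftrightarrow> S \<noteq> T \<and> S \<inter> T \<inter> ball z r \<noteq> {}"

(* As usual in Graph_Theory, an undirected graph is a symmetric loop-free digraph,
   see circle_graph_imp_pair_graph below. *)
definition circle_graph :: "complex set pair_pre_digraph \<Rightarrow> bool" where
  "circle_graph G \<longleftrightarrow> (\<exists>z r. r > 0 \<and> finite (pverts G) \<and> pverts G \<subseteq> chords z r \<and>
     parcs G = {(S, T). S \<in> pverts G \<and> T \<in> pverts G \<and> cross z r S T})"

definition independent_set :: "'a pair_pre_digraph \<Rightarrow> 'a set \<Rightarrow> bool" where
  "independent_set G I \<longleftrightarrow> I \<subseteq> pverts G \<and> (\<forall>u\<in>I. \<forall>v\<in>I. (u, v) \<notin> parcs G)"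

definition independence_number :: "'a pair_pre_digraph \<Rightarrow> nat" where
  "independence_number G = Max (card ` {I. independent_set G I})"

definition maximum_independent_set :: "'a pair_pre_digraph \<Rightarrow> 'a set \<Rightarrow> bool" where
  "maximum_independent_set G I \<longleftrightarrow> independent_set G I \<and> card I = independence_number G"

definition hitting_set :: "'a pair_pre_digraph \<Rightarrow> 'a set \<Rightarrow> bool" where
  "hitting_set G T \<longleftrightarrow> T \<subseteq> pverts G \<and> (\<forall>I. maximum_independent_set G I \<longrightarrow> T \<inter> I \<noteq> {})"

(* For finite graphs. The graph without vertices has no hitting set, as its maximum
   independent set is empty; every other finite simple graph has one, namely pverts G. *)
definition hitting_number :: "'a pair_pre_digraph \<Rightarrow> nat" where
  "hitting_number G = Min (card ` {T. hitting_set G T})"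

lemma circle_graph_imp_pair_graph:
  assumes "circle_graph G"
  shows "pair_graph G"
proof -
  obtain z r where fin: "finite (pverts G)"
    and arcs: "parcs G = {(S, T). S \<in> pverts G \<and> T \<in> pverts G \<and> cross z r S T}"
    using assms unfolding circle_graph_def by blast
  have "finite (parcs G)"
    by (rule finite_subset[of _ "pverts G \<times> pverts G"]) (auto simp: arcs fin)
  moreover have "symmetric G"
    by (auto simp: symmetric_def sym_def arcs cross_def)
  ultimately show ?thesis
    by unfold_locales (auto simp: arcs fin cross_def)
qed

lemma hitting_set_pverts:
  assumes "pair_graph G" "pverts G \<noteq> {}"
  shows "hitting_set G (pverts G)"
proof -
  interpret pair_graph G by fact
  obtain v where v: "v \<in> pverts G" using assms(2) by blast
  have "independent_set G {v}"
    using v pair_no_loops[of "(v, v)"] by (auto simp: independent_set_def)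
  moreover have "finite {I. independent_set G I}"
    by (rule finite_subset[of _ "Pow (pverts G)"])
      (auto simp: independent_set_def pair_finite_verts)
  ultimately have "card {v} \<le> independence_number G"
    unfolding independence_number_def by (intro Max_ge finite_imageI imageI CollectI)
  then have "I \<subseteq> pverts G \<and> I \<noteq> {}" if "maximum_independent_set G I" for I
    using that by (auto simp: maximum_independent_set_def independent_set_def)
  then show ?thesis unfolding hitting_set_def by blast
qed

end

theory Submission
  imports Defs "HOL-Real_Asymp.Real_Asymp"
begin

text \<open>Cutting the circle open turns chords into intervals, and crossing into overlapping.
  Fix \<open>m\<close> of order \<open>n / log n\<close> and group the \<open>2n\<close> interval ends into about \<open>2 log n\<close> blocks of \<open>m\<close>
  consecutive ends. If some chord has both ends in one block, it has degree less than \<open>m\<close>, and its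
  closed neighbourhood is a hitting set. Otherwise the members of an independent set that join the
  same two blocks are nested, and the outermost and innermost ones for all pairs of blocks form a
  set \<open>E\<close> of size polylogarithmic in \<open>n\<close>. All maximum independent sets with the same \<open>E\<close> are, for
  each pair of blocks, longest chains of nested chords between the same two extreme chords; hence
  each of them meets all \<open>cn\<close> of the disjoint Mirsky levels determined by \<open>E\<close>, half of which have at
  most \<open>2/c\<close> elements. For a random colouring of the vertices with \<open>log n\<close> colours, the probability
  that a given colour class contains no level of a given \<open>E\<close> is exponentially small compared with the
  number of possible \<open>E\<close>, so in some colouring every colour class, in particular the smallest one,
  is a hitting set.\<close>

section \<open>Chords as intervals\<close>

text \<open>Strictness matters: intervals sharing an end do not overlap, just as chords that meet
  only on the circle do not cross.\<close>

definition overlap :: "real \<Rightarrow> real \<Rightarrow> real \<Rightarrow> real \<Rightarrow> bool" where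
  "overlap a b c d \<longleftrightarrow> a < c \<and> c < b \<and> b < d \<or> c < a \<and> a < d \<and> d < b"

lemma overlap_commute: "overlap a b c d \<longleftrightarrow> overlap c d a b"
  by (auto simp: overlap_def)

section \<open>Sides of the line through a chord\<close>

definition circle_point :: "complex \<Rightarrow> real \<Rightarrow> real \<Rightarrow> complex" where
  "circle_point z r t = z + of_real r * cis t"

text \<open>Signed distance from the line through the points with angles \<open>a\<close> and \<open>b\<close>.\<close>

definition chord_side :: "complex \<Rightarrow> real \<Rightarrow> real \<Rightarrow> real \<Rightarrow> complex \<Rightarrow> real" where
  "chord_side z r a b x = (x - z) \<bullet> cis ((a + b) / 2) - r * cos ((a - b) / 2)"

text \<open>\<open>chord_side\<close> is affine in the point, so its values along a segment are
  interpolated from the two ends.\<close>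

lemma chord_side_convex:
  "chord_side z r a b ((1 - u) *\<^sub>R x + u *\<^sub>R y)
    = (1 - u) * chord_side z r a b x + u * chord_side z r a b y"
proof -
  have "(1 - u) *\<^sub>R x + u *\<^sub>R y - z = (1 - u) *\<^sub>R (x - z) + u *\<^sub>R (y - z)"
    by (simp add: scaleR_diff_left scaleR_diff_right)
  then show ?thesis
    unfolding chord_side_def by (simp add: inner_left_distrib) (simp add: algebra_simps)
qed

text \<open>The sum-to-product formula splits the distance into two sines whose signs can be read
  off separately.\<close>

lemma chord_side_circle_point:
  "chord_side z r a b (circle_point z r t) = - 2 * r * sin ((t - a) / 2) * sin ((t - b) / 2)"
proof -
  have "cis t \<bullet> cis ((a + b) / 2) = cos (t - (a + b) / 2)"
    by (simp add: inner_complex_def cos_diff)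
  then have "chord_side z r a b (circle_point z r t)
      = r * (cos (t - (a + b) / 2) - cos ((a - b) / 2))"
    unfolding chord_side_def circle_point_def
    by (simp add: inner_complex_def right_diff_distrib mult.assoc flip: distrib_left)
  also have "cos (t - (a + b) / 2) - cos ((a - b) / 2)
      = - 2 * sin ((t - a) / 2) * sin ((t - b) / 2)"
  proof -
    have "(t - (a + b) / 2 + (a - b) / 2) / 2 = (t - b) / 2"
      "((a - b) / 2 - (t - (a + b) / 2)) / 2 = - ((t - a) / 2)" by (simp_all add: field_simps)
    then show ?thesis by (simp only: cos_diff_cos sin_minus) simp
  qed
  finally show ?thesis by simp
qed

text \<open>The half difference lies strictly between -pi and pi, where sine has the sign of its
  argument.\<close>

lemma sgn_sin_half_diff:
  assumes "t \<in> {0..<2*pi}" "a \<in> {0..<2*pi}"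
  shows "sgn (sin ((t - a) / 2)) = sgn (t - a)"
proof -
  consider "t = a" | "t > a" | "t < a" by linarith
  then show ?thesis
  proof cases
    case 2
    then have "sin ((t - a) / 2) > 0" using assms by (intro sin_gt_zero) auto
    with 2 show ?thesis by simp
  next
    case 3
    then have "sin ((a - t) / 2) > 0" using assms by (intro sin_gt_zero) auto
    moreover have "sin ((t - a) / 2) = - sin ((a - t) / 2)"
      by (simp flip: sin_minus add: minus_divide_left)
    ultimately show ?thesis using 3 by simp
  qed simp
qed

lemma sgn_chord_side:
  assumes "r > 0" "t \<in> {0..<2*pi}" "a \<in> {0..<2*pi}" "b \<in> {0..<2*pi}"
  shows "sgn (chord_side z r a b (circle_point z r t)) = - (sgn (t - a) * sgn (t - b))"
  unfolding chord_side_circle_point using assms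
  by (simp add: sgn_mult sgn_sin_half_diff)

lemma chord_side_cases:
  assumes "r > 0" "t \<in> {0..<2*pi}" "a \<in> {0..<2*pi}" "b \<in> {0..<2*pi}" "a < b"
  shows "chord_side z r a b (circle_point z r t) > 0 \<longleftrightarrow> a < t \<and> t < b"
    and "chord_side z r a b (circle_point z r t) < 0 \<longleftrightarrow> t < a \<or> b < t"
    and "chord_side z r a b (circle_point z r t) = 0 \<longleftrightarrow> t = a \<or> t = b"
  using sgn_chord_side[OF assms(1-4), of z] assms(5)
  by (auto simp: sgn_if split: if_splits)

lemma perpendicular_imp_parallel:
  fixes u v w :: complex
  assumes "u \<noteq> 0" "v \<bullet> u = 0" "w \<bullet> u = 0" "w \<noteq> 0"
  obtains t where "v = t *\<^sub>R w"
proof -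
  have v: "Re v * Re u + Im v * Im u = 0" and w: "Re w * Re u + Im w * Im u = 0"
    using assms(2,3) by (auto simp: inner_complex_def)
  \<comment> \<open>Both coordinates of \<open>u\<close> annihilate the determinant of
    \<open>v\<close> and \<open>w\<close>, so it vanishes.\<close>
  have "Re u * (Re v * Im w - Re w * Im v) = 0" "Im u * (Re v * Im w - Re w * Im v) = 0"
    using v w by algebra+
  then have det: "Re v * Im w = Re w * Im v"
    using assms(1) by (auto simp: complex_eq_iff)
  show thesis
  proof (cases "Re w = 0")
    case True
    then have "Im w \<noteq> 0" using assms(4) by (auto simp: complex_eq_iff)
    with True det show thesis by (intro that[of "Im v / Im w"]) (auto simp: complex_eq_iff)
  next
    case False
    with det show thesis
      by (intro that[of "Re v / Re w"]) (auto simp: complex_eq_iff field_simps)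
  qed
qed

lemma circle_point_in_sphere: "r > 0 \<Longrightarrow> circle_point z r t \<in> sphere z r"
  by (simp add: circle_point_def dist_norm norm_mult)

lemma in_open_segment_if_in_ball:
  assumes "x \<in> closed_segment p q" "x \<in> ball z r" "p \<in> sphere z r" "q \<in> sphere z r"
  obtains u where "0 < u" "u < 1" "x = (1 - u) *\<^sub>R p + u *\<^sub>R q"
proof -
  obtain u where u: "0 \<le> u" "u \<le> 1" "x = (1 - u) *\<^sub>R p + u *\<^sub>R q"
    using assms(1) by (auto simp: in_segment)
  have "u \<noteq> 0" "u \<noteq> 1" using u(3) assms(2-4) by (auto simp: dist_commute)
  with u show thesis by (intro that[of u]) simp_all
qed

text \<open>Each chord has its ends on opposite sides of the line through the other. So the point
  where the second chord meets the line of the first lies on both chords.\<close>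

lemma overlap_imp_cross:
  assumes r: "r > 0" and rng: "{a, b, c, d} \<subseteq> {0..<2*pi}"
    and ord: "a < c" "c < b" "b < d"
  shows "cross z r (closed_segment (circle_point z r a) (circle_point z r b))
                   (closed_segment (circle_point z r c) (circle_point z r d))"
proof -
  let ?p = "circle_point z r"
  define f where "f = chord_side z r a b"
  define g where "g = chord_side z r c d"
  have f: "f (?p a) = 0" "f (?p b) = 0" "f (?p c) > 0" "f (?p d) < 0"
    unfolding f_def using r rng ord by (auto simp: chord_side_cases)
  have g: "g (?p c) = 0" "g (?p d) = 0" "g (?p a) < 0" "g (?p b) > 0"
    unfolding g_def using r rng ord by (auto simp: chord_side_cases)
  \<comment> \<open>The parameter at which the affine function \<open>f\<close> vanishes between its
    values at \<open>c\<close> and \<open>d\<close>.\<close>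
  define u where "u = f (?p c) / (f (?p c) - f (?p d))"
  define x where "x = (1 - u) *\<^sub>R ?p c + u *\<^sub>R ?p d"
  have u: "0 < u" "u < 1" using f by (auto simp: u_def field_simps)
  have "f x = (1 - u) * f (?p c) + u * f (?p d)"
    unfolding f_def x_def by (rule chord_side_convex)
  also have "\<dots> = f (?p c) - u * (f (?p c) - f (?p d))" by (simp add: algebra_simps)
  also have "\<dots> = 0" using f by (simp add: u_def)
  finally have fx: "f x = 0" .
  have "g x = (1 - u) * g (?p c) + u * g (?p d)"
    unfolding g_def x_def by (rule chord_side_convex)
  then have gx: "g x = 0" using g by simp
  have ne: "?p a \<noteq> ?p b" using g by auto
  have perp: "(x - ?p a) \<bullet> cis ((a + b) / 2) = 0" "(?p b - ?p a) \<bullet> cis ((a + b) / 2) = 0"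
    using fx f(1,2) by (auto simp: f_def chord_side_def inner_diff_left)
  obtain t where "x - ?p a = t *\<^sub>R (?p b - ?p a)"
    using perpendicular_imp_parallel[OF cis_neq_zero perp] ne by auto
  then have t: "x = (1 - t) *\<^sub>R ?p a + t *\<^sub>R ?p b"
    by (simp add: algebra_simps)
  \<comment> \<open>\<open>g\<close> is negative at \<open>a\<close>, positive at \<open>b\<close>
    and zero at \<open>x\<close>, which forces \<open>t\<close> strictly between 0 and 1.\<close>
  have "g x = (1 - t) * g (?p a) + t * g (?p b)"
    unfolding g_def t by (rule chord_side_convex)
  then have tg: "t * (g (?p b) - g (?p a)) = - g (?p a)" using gx by (simp add: algebra_simps)
  have "t > 0" using tg g by (smt (verit) mult_nonpos_nonneg)
  moreover have "t < 1"
  proof (rule ccontr)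
    assume "\<not> t < 1"
    then have "1 * (g (?p b) - g (?p a)) \<le> t * (g (?p b) - g (?p a))"
      using g by (intro mult_right_mono) auto
    then show False using tg g by simp
  qed
  ultimately have xab: "x \<in> closed_segment (?p a) (?p b)"
    using t by (auto simp: in_segment intro!: exI[of _ t])
  have xcd: "x \<in> closed_segment (?p c) (?p d)"
    using u by (auto simp: in_segment x_def intro!: exI[of _ u])
  have "?p c \<noteq> ?p d" using f by auto
  then have "x \<in> open_segment (?p c) (?p d)"
    using u by (auto simp: in_segment x_def intro!: exI[of _ u])
  \<comment> \<open>An interior point of a segment is strictly closer to the centre than the farther
    end.\<close>
  then have "dist x z < max (dist (?p c) z) (dist (?p d) z)"
    using dist_decreases_open_segment[of x "?p c" "?p d" z] by (auto simp: dist_commute)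
  then have "x \<in> ball z r" using circle_point_in_sphere[OF r, of z] by (auto simp: dist_commute)
  \<comment> \<open>\<open>f\<close> vanishes on the whole first chord but not at the end
    \<open>c\<close> of the second.\<close>
  moreover have "closed_segment (?p a) (?p b) \<noteq> closed_segment (?p c) (?p d)"
  proof
    assume "closed_segment (?p a) (?p b) = closed_segment (?p c) (?p d)"
    then have "?p c \<in> closed_segment (?p a) (?p b)"
      by (metis ends_in_segment(1))
    then obtain v where v: "?p c = (1 - v) *\<^sub>R ?p a + v *\<^sub>R ?p b" by (auto simp: in_segment)
    have "f (?p c) = (1 - v) * f (?p a) + v * f (?p b)"
      unfolding f_def by (subst v) (rule chord_side_convex)
    then show False using f by simp
  qed
  ultimately show ?thesis using xab xcd unfolding cross_def by blast
qed

text \<open>Without overlap, \<open>c\<close> and \<open>d\<close> lie on the same closed side of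
  the first chord. A common point interior to the second chord then forces both onto the line of the
  first, so the chords coincide, which \<open>cross\<close> excludes.\<close>

lemma cross_imp_overlap:
  assumes r: "r > 0" and rng: "{a, b, c, d} \<subseteq> {0..<2*pi}" and ord: "a < b" "c < d"
    and cr: "cross z r (closed_segment (circle_point z r a) (circle_point z r b))
                   (closed_segment (circle_point z r c) (circle_point z r d))"
  shows "overlap a b c d"
proof (rule ccontr)
  let ?p = "circle_point z r"
  define f where "f = chord_side z r a b"
  assume no: "\<not> overlap a b c d"
  obtain x where x: "x \<in> closed_segment (?p a) (?p b)" "x \<in> closed_segment (?p c) (?p d)"
      "x \<in> ball z r"
    using cr unfolding cross_def by blast
  obtain v where v: "x = (1 - v) *\<^sub>R ?p a + v *\<^sub>R ?p b" using x(1) by (auto simp: in_segment)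
  have f0: "f (?p a) = 0" "f (?p b) = 0"
    unfolding f_def using r rng ord by (auto simp: chord_side_cases)
  have "f x = (1 - v) * f (?p a) + v * f (?p b)"
    unfolding f_def v by (rule chord_side_convex)
  then have fx: "f x = 0" using f0 by simp
  obtain u where u: "0 < u" "u < 1" "x = (1 - u) *\<^sub>R ?p c + u *\<^sub>R ?p d"
    using in_open_segment_if_in_ball[OF x(2,3)] circle_point_in_sphere[OF r] by metis
  have eq: "(1 - u) * f (?p c) + u * f (?p d) = 0"
    using fx unfolding f_def u(3) chord_side_convex by simp
  have "f (?p c) \<ge> 0 \<and> f (?p d) \<ge> 0 \<or> f (?p c) \<le> 0 \<and> f (?p d) \<le> 0"
    unfolding f_def using no r rng ord
    by (simp add: chord_side_cases not_less[symmetric] overlap_def) linarith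
  then have "f (?p c) = 0 \<and> f (?p d) = 0"
  proof
    assume A: "f (?p c) \<ge> 0 \<and> f (?p d) \<ge> 0"
    then have "(1 - u) * f (?p c) = 0 \<and> u * f (?p d) = 0"
      using eq u by (subst (asm) add_nonneg_eq_0_iff) auto
    then show ?thesis using u by auto
  next
    assume A: "f (?p c) \<le> 0 \<and> f (?p d) \<le> 0"
    then have "(1 - u) * f (?p c) = 0 \<and> u * f (?p d) = 0"
      using eq u by (subst (asm) add_nonpos_eq_0_iff) (auto simp: mult_nonneg_nonpos)
    then show ?thesis using u by auto
  qed
  then have "c = a \<and> d = b" unfolding f_def using r rng ord by (auto simp: chord_side_cases)
  then show False using cr by (auto simp: cross_def)
qed

lemma cross_iff_overlap:
  assumes r: "r > 0" and rng: "{a, b, c, d} \<subseteq> {0..<2*pi}" and ord: "a < b" "c < d"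
  shows "cross z r (closed_segment (circle_point z r a) (circle_point z r b))
                   (closed_segment (circle_point z r c) (circle_point z r d))
    \<longleftrightarrow> overlap a b c d"
proof
  assume "overlap a b c d"
  then consider "a < c" "c < b" "b < d" | "c < a" "a < d" "d < b" by (auto simp: overlap_def)
  then show "cross z r (closed_segment (circle_point z r a) (circle_point z r b))
                   (closed_segment (circle_point z r c) (circle_point z r d))"
  proof cases
    case 1
    with r rng show ?thesis by (intro overlap_imp_cross)
  next
    case 2
    with r rng have "cross z r (closed_segment (circle_point z r c) (circle_point z r d))
                   (closed_segment (circle_point z r a) (circle_point z r b))"
      by (intro overlap_imp_cross) auto
    then show ?thesis by (auto simp: cross_def)
  qed
qed (rule cross_imp_overlap[OF assms])

section \<open>From circle graphs to overlap graphs\<close>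

lemma sphere_eq_circle_point:
  assumes "r > 0" "x \<in> sphere z r"
  obtains t where "t \<in> {0..<2*pi}" "x = circle_point z r t"
proof
  show "Arg2pi (x - z) \<in> {0..<2*pi}" using Arg2pi[of "x - z"] by auto
  have "x - z = of_real (norm (x - z)) * exp (\<i> * of_real (Arg2pi (x - z)))"
    using Arg2pi[of "x - z"] by (simp add: is_Arg_def)
  then show "x = circle_point z r (Arg2pi (x - z))"
    using assms by (simp add: circle_point_def dist_norm norm_minus_commute cis_conv_exp algebra_simps)
qed

lemma chord_angles:
  assumes "r > 0" "S \<in> chords z r"
  obtains a b where "a \<in> {0..<2*pi}" "b \<in> {0..<2*pi}" "a < b"
    "S = closed_segment (circle_point z r a) (circle_point z r b)"
proof -
  obtain p q where pq: "p \<in> sphere z r" "q \<in> sphere z r" "p \<noteq> q" "S = closed_segment p q"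
    using assms(2) by (auto simp: chords_def)
  obtain a where a: "a \<in> {0..<2*pi}" "p = circle_point z r a"
    using sphere_eq_circle_point[OF assms(1) pq(1)] .
  obtain b where b: "b \<in> {0..<2*pi}" "q = circle_point z r b"
    using sphere_eq_circle_point[OF assms(1) pq(2)] .
  have "a \<noteq> b" using pq a b by auto
  then consider "a < b" | "b < a" by linarith
  then show thesis
  proof cases
    case 1
    then show ?thesis using that[OF a(1) b(1)] a b pq(4) by auto
  next
    case 2
    then show ?thesis using that[OF b(1) a(1)] a b pq(4) closed_segment_commute by metis
  qed
qed

text \<open>Distinct chords may share one end but not both; \<open>inj_ends\<close> keeps this fact
  once chords are no longer point sets.\<close>

locale overlap_graph =
  fixes G :: "'a pair_pre_digraph" and lo hi :: "'a \<Rightarrow> real"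
  assumes finite_verts: "finite (pverts G)"
    and lo_less_hi: "v \<in> pverts G \<Longrightarrow> lo v < hi v"
    and inj_ends: "inj_on (\<lambda>v. (lo v, hi v)) (pverts G)"
    and arcs_iff: "(u, v) \<in> parcs G \<longleftrightarrow>
      u \<in> pverts G \<and> v \<in> pverts G \<and> overlap (lo u) (hi u) (lo v) (hi v)"

lemma circle_graph_imp_overlap_graph:
  assumes "circle_graph G"
  obtains lo hi where "overlap_graph G lo hi"
proof -
  obtain z r where r: "r > 0" and fin: "finite (pverts G)" and sub: "pverts G \<subseteq> chords z r"
    and arcs: "parcs G = {(S, T). S \<in> pverts G \<and> T \<in> pverts G \<and> cross z r S T}"
    using assms unfolding circle_graph_def by blast
  have "\<forall>S\<in>pverts G. \<exists>ab. fst ab \<in> {0..<2*pi} \<and> snd ab \<in> {0..<2*pi} \<and> fst ab < snd ab \<and>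
      S = closed_segment (circle_point z r (fst ab)) (circle_point z r (snd ab))"
    using chord_angles[OF r] sub by (metis fst_conv snd_conv subsetD)
  then obtain e where e: "\<And>S. S \<in> pverts G \<Longrightarrow> fst (e S) \<in> {0..<2*pi} \<and> snd (e S) \<in> {0..<2*pi} \<and>
      fst (e S) < snd (e S) \<and>
      S = closed_segment (circle_point z r (fst (e S))) (circle_point z r (snd (e S)))"
    using bchoice by metis
  have "cross z r S T \<longleftrightarrow> overlap (fst (e S)) (snd (e S)) (fst (e T)) (snd (e T))"
    if "S \<in> pverts G" "T \<in> pverts G" for S T
    using cross_iff_overlap[OF r, of "fst (e S)" "snd (e S)" "fst (e T)" "snd (e T)" z]
      e[OF that(1)] e[OF that(2)] by auto
  moreover have "inj_on (\<lambda>S. (fst (e S), snd (e S))) (pverts G)"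
    using e by (intro inj_onI) (metis prod.inject)
  ultimately have "overlap_graph G (fst \<circ> e) (snd \<circ> e)"
    by unfold_locales (auto simp: fin arcs e)
  then show thesis by (rule that)
qed


section \<open>Colour classes containing a member of every family\<close>

text \<open>This is independence in counting form: under a uniform colouring, a set of at most
  \<open>b\<close> elements gets only colour \<open>i\<close> with probability at least
  \<open>1 / real s ^ b\<close>, and disjoint sets behave independently. The induction splits a
  colouring into its restrictions to \<open>L\<close> and to the rest.\<close>

lemma card_colourings_avoiding:
  fixes V :: "'a set" and s b i :: nat
  assumes "finite \<L>" "finite V" "disjoint \<L>" "\<Union>\<L> \<subseteq> V" "\<And>L. L \<in> \<L> \<Longrightarrow> card L \<le> b" "i < s"
  shows "real (card {f \<in> V \<rightarrow>\<^sub>E {..<s}. \<forall>L\<in>\<L>. \<not> f ` L \<subseteq> {i}})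
    \<le> real s ^ card V * (1 - 1 / real s ^ b) ^ card \<L>"
  using assms
proof (induction \<L> arbitrary: V rule: finite_induct)
  case empty
  then show ?case by (simp add: card_PiE)
next
  case (insert L \<L>)
  have finL: "finite L" and LV: "L \<subseteq> V"
    using insert.prems by (auto intro: finite_subset)
  have s1: "real s \<ge> 1" using insert.prems by simp
  let ?bad = "\<lambda>\<L> V. {f \<in> V \<rightarrow>\<^sub>E {..<s}. \<forall>L\<in>\<L>. \<not> f ` L \<subseteq> {i}}"
  \<comment> \<open>The colourings of \<open>L\<close> other than the constant one with value
    \<open>i\<close>.\<close>
  let ?A = "(L \<rightarrow>\<^sub>E {..<s}) - {restrict (\<lambda>_. i) L}"
  have dis: "M \<subseteq> V - L" if "M \<in> \<L>" for M
    using insert.prems insert.hyps that by (auto simp: disjoint_def)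
  have IH: "real (card (?bad \<L> (V - L))) \<le> real s ^ card (V - L) * (1 - 1 / real s ^ b) ^ card \<L>"
    using insert.prems dis by (intro insert.IH) (auto simp: disjoint_def)
  have fin: "finite ?A" "finite (?bad \<L> (V - L))"
    using finL insert.prems
    by (auto intro!: finite_PiE finite_subset[of "?bad \<L> (V - L)" "(V - L) \<rightarrow>\<^sub>E {..<s}"])
  let ?split = "\<lambda>f. (restrict f L, restrict f (V - L))"
  have "inj_on ?split (?bad (insert L \<L>) V)"
  proof (rule inj_onI)
    fix f g assume f: "f \<in> ?bad (insert L \<L>) V" and g: "g \<in> ?bad (insert L \<L>) V"
      and eq: "?split f = ?split g"
    have "f x = g x" if "x \<in> V" for x
      using eq that by (cases "x \<in> L") (auto dest: fun_cong[of _ _ x])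
    then show "f = g" using f g by (intro PiE_ext[of f V "\<lambda>_. {..<s}" g]) auto
  qed
  moreover have "?split ` ?bad (insert L \<L>) V \<subseteq> ?A \<times> ?bad \<L> (V - L)"
  proof (rule image_subsetI)
    fix f assume f: "f \<in> ?bad (insert L \<L>) V"
    have "restrict f L \<noteq> restrict (\<lambda>_. i) L"
    proof
      assume "restrict f L = restrict (\<lambda>_. i) L"
      then have "f x = i" if "x \<in> L" for x using that by (metis restrict_apply')
      then show False using f by auto
    qed
    moreover have "restrict f L \<in> L \<rightarrow>\<^sub>E {..<s}" using f LV by (auto simp: PiE_iff)
    moreover have "restrict f (V - L) \<in> (V - L) \<rightarrow>\<^sub>E {..<s}" using f by (auto simp: PiE_iff)
    moreover have "restrict f (V - L) ` M = f ` M" if "M \<in> \<L>" for M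
      using dis[OF that] by (intro image_cong) auto
    ultimately show "?split f \<in> ?A \<times> ?bad \<L> (V - L)" using f by auto
  qed
  ultimately have "card (?bad (insert L \<L>) V) \<le> card (?A \<times> ?bad \<L> (V - L))"
    using fin by (intro card_inj_on_le) auto
  also have "\<dots> = card ?A * card (?bad \<L> (V - L))" by (rule card_cartesian_product)
  finally have le: "real (card (?bad (insert L \<L>) V)) \<le> real (card ?A) * real (card (?bad \<L> (V - L)))"
    by (simp flip: of_nat_mult)
  have "restrict (\<lambda>_. i) L \<in> L \<rightarrow>\<^sub>E {..<s}" using insert.prems by auto
  then have "real (card ?A) = real s ^ card L - 1"
    using finL insert.prems by (simp add: card_Diff_singleton card_PiE of_nat_diff)
  also have "\<dots> \<le> real s ^ card L * (1 - 1 / real s ^ b)"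
  proof -
    have "real s ^ card L \<le> real s ^ b" using s1 insert.prems by (intro power_increasing) auto
    moreover have "real s ^ b > 0" using s1 by simp
    ultimately show ?thesis by (simp add: field_simps)
  qed
  finally have "real (card ?A) \<le> real s ^ card L * (1 - 1 / real s ^ b)" .
  moreover have "0 \<le> 1 - 1 / real s ^ b" using s1 by simp
  ultimately have "real (card (?bad (insert L \<L>) V)) \<le> (real s ^ card L * (1 - 1 / real s ^ b)) *
      (real s ^ card (V - L) * (1 - 1 / real s ^ b) ^ card \<L>)"
    using IH s1 by (intro order.trans[OF le] mult_mono) auto
  also have "\<dots> = real s ^ (card L + card (V - L)) * (1 - 1 / real s ^ b) ^ card (insert L \<L>)"
    using insert.hyps by (simp add: power_add)
  also have "card L + card (V - L) = card V"
    using finL LV insert.prems by (simp add: card_Diff_subset card_mono)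
  finally show ?case .
qed

text \<open>A union bound over all pairs of an index and a colour leaves a colouring in which every
  colour class contains a member of every family; the smallest class is then taken.\<close>

lemma small_set_containing_members:
  fixes V :: "'a set" and X :: "'b set" and \<L> :: "'b \<Rightarrow> 'a set set" and s b :: nat and l :: real
  assumes finV: "finite V" and finX: "finite X" and s: "s > 0"
    and dis: "\<And>x. x \<in> X \<Longrightarrow> disjoint (\<L> x)" and sub: "\<And>x. x \<in> X \<Longrightarrow> \<Union>(\<L> x) \<subseteq> V"
    and small: "\<And>x L. x \<in> X \<Longrightarrow> L \<in> \<L> x \<Longrightarrow> card L \<le> b"
    and many: "\<And>x. x \<in> X \<Longrightarrow> l \<le> real (card (\<L> x))"
    and bound: "real (card X) * real s * exp (- (l / real s ^ b)) < 1"
  obtains R where "R \<subseteq> V" "s * card R \<le> card V" "\<forall>x\<in>X. \<exists>L\<in>\<L> x. L \<subseteq> R"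
proof -
  let ?bad = "\<lambda>(x, i). {f \<in> V \<rightarrow>\<^sub>E {..<s}. \<forall>L\<in>\<L> x. \<not> f ` L \<subseteq> {i}}"
  have s1: "real s \<ge> 1" using s by simp
  have bad: "real (card (?bad p)) \<le> real s ^ card V * exp (- (l / real s ^ b))"
    if pX: "p \<in> X \<times> {..<s}" for p
  proof -
    obtain x i where p: "p = (x, i)" "x \<in> X" "i < s" using pX by auto
    have "finite (\<L> x)" using sub[OF p(2)] finV by (meson finite_UnionD finite_subset)
    then have "real (card (?bad p)) \<le> real s ^ card V * (1 - 1 / real s ^ b) ^ card (\<L> x)"
      unfolding p(1) prod.case using p dis sub small finV by (intro card_colourings_avoiding) auto
    also have "(1 - 1 / real s ^ b) ^ card (\<L> x) \<le> exp (- (1 / real s ^ b)) ^ card (\<L> x)"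
      using s1 exp_ge_add_one_self[of "- (1 / real s ^ b)"] by (intro power_mono) auto
    also have "\<dots> = exp (- (real (card (\<L> x)) / real s ^ b))"
      by (simp flip: exp_of_nat_mult)
    also have "\<dots> \<le> exp (- (l / real s ^ b))"
      using many[OF p(2)] by (simp add: divide_right_mono)
    finally show ?thesis by (simp add: mult_left_mono)
  qed
  define U where "U = (\<Union>p\<in>X \<times> {..<s}. ?bad p)"
  have "real (card U) \<le> (\<Sum>p\<in>X \<times> {..<s}. real (card (?bad p)))"
    unfolding U_def using card_UN_le[of "X \<times> {..<s}" ?bad] finX by (simp flip: of_nat_sum)
  also have "\<dots> \<le> (\<Sum>p\<in>X \<times> {..<s}. real s ^ card V * exp (- (l / real s ^ b)))"
    by (rule sum_mono) (rule bad)
  also have "\<dots> = real s ^ card V * (real (card X) * real s * exp (- (l / real s ^ b)))"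
    by (simp add: card_cartesian_product)
  also have "\<dots> < real s ^ card V * 1"
    using s1 by (intro mult_strict_left_mono bound) auto
  also have "\<dots> = real (card (V \<rightarrow>\<^sub>E {..<s}))" using finV by (simp add: card_PiE)
  finally have "card U < card (V \<rightarrow>\<^sub>E {..<s})" by simp
  moreover have "finite U"
    unfolding U_def using finV by (intro finite_subset[OF _ finite_PiE[of V "\<lambda>_. {..<s}"]]) auto
  ultimately have "\<not> V \<rightarrow>\<^sub>E {..<s} \<subseteq> U"
    using card_mono[of U "V \<rightarrow>\<^sub>E {..<s}"] by linarith
  then obtain f where f: "f \<in> V \<rightarrow>\<^sub>E {..<s}" "f \<notin> U" by blast
  have "(\<Sum>i<s. card {v \<in> V. f v = i}) = card (\<Union>i<s. {v \<in> V. f v = i})"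
    using finV by (subst card_UN_disjoint) auto
  also have "(\<Union>i<s. {v \<in> V. f v = i}) = V" using f(1) by auto
  finally have tot: "(\<Sum>i<s. card {v \<in> V. f v = i}) = card V" .
  \<comment> \<open>Some class is no larger than the average.\<close>
  have "\<exists>i<s. s * card {v \<in> V. f v = i} \<le> card V"
  proof (rule ccontr)
    assume "\<not> ?thesis"
    then have "(\<Sum>i<s. card V) < (\<Sum>i<s. s * card {v \<in> V. f v = i})"
      using s by (intro sum_strict_mono) (auto simp: not_le)
    then show False using tot by (simp flip: sum_distrib_left)
  qed
  then obtain i where i: "i < s" "s * card {v \<in> V. f v = i} \<le> card V" by auto
  show thesis
  proof (rule that[of "{v \<in> V. f v = i}"])
    show "\<forall>x\<in>X. \<exists>L\<in>\<L> x. L \<subseteq> {v \<in> V. f v = i}"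
    proof
      fix x assume x: "x \<in> X"
      with f i have "\<exists>L\<in>\<L> x. f ` L \<subseteq> {i}" by (auto simp: U_def)
      then obtain L where "L \<in> \<L> x" "f ` L \<subseteq> {i}" by blast
      then show "\<exists>L\<in>\<L> x. L \<subseteq> {v \<in> V. f v = i}" using sub[OF x] by (intro bexI[of _ L]) auto
    qed
  qed (use i in auto)
qed

section \<open>Hitting sets\<close>

lemma card_le_independence_number:
  assumes "finite (pverts G)" "independent_set G I"
  shows "card I \<le> independence_number G"
proof -
  have "finite {I. independent_set G I}"
    using assms(1) by (auto simp: independent_set_def intro: finite_subset[of _ "Pow (pverts G)"])
  then show ?thesis
    unfolding independence_number_def using assms(2) by (intro Max_ge) auto
qed

lemma hitting_number_le:
  assumes "finite (pverts G)" "hitting_set G T"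
  shows "hitting_number G \<le> card T"
proof -
  have "finite {T. hitting_set G T}"
    using assms(1) by (auto simp: hitting_set_def intro: finite_subset[of _ "Pow (pverts G)"])
  then show ?thesis
    unfolding hitting_number_def using assms(2) by (intro Min_le) auto
qed

text \<open>A maximum independent set avoiding the closed neighbourhood could be enlarged by
  \<open>v\<close>.\<close>

lemma hitting_set_closed_neighbourhood:
  assumes "pair_graph G" "v \<in> pverts G"
  shows "hitting_set G {u \<in> pverts G. u = v \<or> (u, v) \<in> parcs G}"
proof -
  interpret pair_graph G by fact
  have "{u \<in> pverts G. u = v \<or> (u, v) \<in> parcs G} \<inter> I \<noteq> {}" if I: "maximum_independent_set G I" for I
  proof
    assume dis: "{u \<in> pverts G. u = v \<or> (u, v) \<in> parcs G} \<inter> I = {}"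
    have ind: "independent_set G I" and sub: "I \<subseteq> pverts G"
      using I by (auto simp: maximum_independent_set_def independent_set_def)
    have sym: "(v, u) \<in> parcs G \<longleftrightarrow> (u, v) \<in> parcs G" for u
      using sym_arcs by (auto simp: symmetric_def elim: symE)
    have "(u, v) \<notin> parcs G" "(v, u) \<notin> parcs G" if "u \<in> I" for u
      using dis sub that sym[of u] by auto
    moreover have "(v, v) \<notin> parcs G" using pair_no_loops[of "(v, v)"] by auto
    moreover have "(u, w) \<notin> parcs G" if "u \<in> I" "w \<in> I" for u w
      using ind that by (simp add: independent_set_def)
    ultimately have "independent_set G (insert v I)"
      using assms(2) sub unfolding independent_set_def by simp
    then have "card (insert v I) \<le> card I"
      using card_le_independence_number[of G] I pair_finite_verts
      by (auto simp: maximum_independent_set_def)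
    moreover have "v \<notin> I" using dis assms(2) by auto
    ultimately show False using finite_subset[OF sub pair_finite_verts] by simp
  qed
  then show ?thesis by (auto simp: hitting_set_def)
qed

context overlap_graph
begin

lemma pair_graph: "pair_graph G"
proof -
  have "finite (parcs G)"
    by (rule finite_subset[of _ "pverts G \<times> pverts G"]) (auto simp: arcs_iff finite_verts)
  moreover have "symmetric G"
    by (auto simp: symmetric_def sym_def arcs_iff overlap_commute)
  moreover have "\<not> overlap a b a b" for a b by (auto simp: overlap_def)
  ultimately show ?thesis
    by unfold_locales (auto simp: arcs_iff finite_verts)
qed

text \<open>Distinct chords may share endpoints, so ends are counted with multiplicity.\<close>

definition end_count :: "real \<Rightarrow> nat" where
  "end_count p = card {u \<in> pverts G. lo u < p} + card {u \<in> pverts G. hi u < p}"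

lemma end_count_mono: "p \<le> q \<Longrightarrow> end_count p \<le> end_count q"
  unfolding end_count_def using finite_verts by (intro add_mono card_mono) auto

lemma end_count_le: "end_count p \<le> 2 * card (pverts G)"
proof -
  have "card {u \<in> pverts G. lo u < p} \<le> card (pverts G)"
    "card {u \<in> pverts G. hi u < p} \<le> card (pverts G)"
    using finite_verts by (auto intro: card_mono)
  then show ?thesis by (simp add: end_count_def)
qed

lemma hitting_number_le_end_count_diff:
  assumes v: "v \<in> pverts G"
  shows "hitting_number G \<le> end_count (hi v) - end_count (lo v)"
proof -
  let ?N = "{u \<in> pverts G. u = v \<or> (u, v) \<in> parcs G}"
  let ?L = "\<lambda>p. {u \<in> pverts G. lo u < p}" and ?H = "\<lambda>p. {u \<in> pverts G. hi u < p}"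
  have lt: "lo v < hi v" by (rule lo_less_hi[OF v])
  have fin: "finite (?L p)" "finite (?H p)" for p using finite_verts by auto
  have mono: "?L (lo v) \<subseteq> ?L (hi v)" "?H (lo v) \<subseteq> ?H (hi v)" using lt by auto
  \<comment> \<open>A chord overlapping \<open>v\<close> has an end strictly between those of
    \<open>v\<close>; \<open>v\<close> itself is counted by its left end.\<close>
  have "?N \<subseteq> (?L (hi v) - ?L (lo v)) \<union> (?H (hi v) - ?H (lo v))"
    using lt by (auto simp: arcs_iff overlap_def)
  then have "card ?N \<le> card ((?L (hi v) - ?L (lo v)) \<union> (?H (hi v) - ?H (lo v)))"
    using fin by (intro card_mono) auto
  also have "\<dots> \<le> card (?L (hi v) - ?L (lo v)) + card (?H (hi v) - ?H (lo v))"
    by (rule card_Un_le)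
  also have "\<dots> = end_count (hi v) - end_count (lo v)"
    using fin mono card_mono[OF fin(1) mono(1)] card_mono[OF fin(2) mono(2)]
    by (simp add: card_Diff_subset end_count_def)
  finally show ?thesis
    using hitting_number_le[OF finite_verts hitting_set_closed_neighbourhood[OF pair_graph v]]
    by linarith
qed

end


section \<open>Nested families of chords\<close>

text \<open>Blocks are the fibres of a monotone map and hence convex. The case of a chord with both
  ends in one block is settled separately by its neighbourhood.\<close>

locale classified_overlap_graph = overlap_graph +
  fixes cls :: "real \<Rightarrow> nat"
  assumes cls_mono: "p \<le> q \<Longrightarrow> cls p \<le> cls q"
    and cls_ends: "v \<in> pverts G \<Longrightarrow> cls (lo v) \<noteq> cls (hi v)"
begin

definition kind :: "'a \<Rightarrow> nat \<times> nat" where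
  "kind v = (cls (lo v), cls (hi v))"

text \<open>Comparing only chords of one kind makes comparability the same as not crossing, so
  independent sets of one kind are chains.\<close>

definition nests :: "'a \<Rightarrow> 'a \<Rightarrow> bool" where
  "nests u w \<longleftrightarrow> kind u = kind w \<and> lo u \<le> lo w \<and> hi w \<le> hi u"

text \<open>Determined by \<open>E\<close> alone, so that it serves all independent sets with
  extreme chords \<open>E\<close> at once.\<close>

definition sandwiched :: "'a set \<Rightarrow> 'a set" where
  "sandwiched E = {w \<in> pverts G. (\<exists>e\<in>E. nests e w) \<and> (\<exists>e\<in>E. nests w e)}"

definition nested :: "'a set \<Rightarrow> bool" where
  "nested C \<longleftrightarrow> (\<forall>x\<in>C. \<forall>y\<in>C. nests x y \<or> nests y x)"

definition depth :: "'a set \<Rightarrow> 'a \<Rightarrow> nat" where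
  "depth E w = Max (card ` {C. C \<subseteq> sandwiched E \<and> nested C \<and> (\<forall>x\<in>C. nests x w)})"

definition level :: "'a set \<Rightarrow> 'a \<Rightarrow> (nat \<times> nat) \<times> nat" where
  "level E w = (kind w, depth E w)"

section \<open>The containment order within a kind\<close>

lemma nests_refl: "nests u u"
  by (simp add: nests_def)

lemma nests_trans: "nests u v \<Longrightarrow> nests v w \<Longrightarrow> nests u w"
  by (auto simp: nests_def)

lemma nests_antisym:
  assumes "u \<in> pverts G" "w \<in> pverts G" "nests u w" "nests w u"
  shows "u = w"
  using assms inj_ends by (auto simp: nests_def inj_on_def)

lemma nests_kind: "nests u w \<Longrightarrow> kind u = kind w"
  by (simp add: nests_def)

lemma cls_less_imp_less: "cls p < cls q \<Longrightarrow> p < q"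
  using cls_mono[of q p] by linarith

lemma cls_lo_less_hi: "v \<in> pverts G \<Longrightarrow> cls (lo v) < cls (hi v)"
  using cls_mono[of "lo v" "hi v"] cls_ends[of v] lo_less_hi[of v] by auto

text \<open>Both left ends lie in an earlier block than both right ends. Hence the intervals cannot
  be disjoint, and containment is the only alternative to overlapping.\<close>

lemma not_arc_iff_nests:
  assumes "u \<in> pverts G" "w \<in> pverts G" "kind u = kind w"
  shows "(u, w) \<notin> parcs G \<longleftrightarrow> nests u w \<or> nests w u"
proof -
  have "lo u < hi w" "lo w < hi u"
    using assms cls_lo_less_hi[of u] cls_lo_less_hi[of w]
    by (auto simp: kind_def intro!: cls_less_imp_less)
  then show ?thesis using assms by (auto simp: arcs_iff overlap_def nests_def)
qed

lemma nested_if_independent: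
  assumes "independent_set G I" "C \<subseteq> I" "\<And>x. x \<in> C \<Longrightarrow> kind x = \<tau>"
  shows "nested C"
  unfolding nested_def
proof (intro ballI)
  fix x y assume xy: "x \<in> C" "y \<in> C"
  then have "x \<in> pverts G" "y \<in> pverts G" "(x, y) \<notin> parcs G"
    using assms(1,2) by (auto simp: independent_set_def)
  then show "nests x y \<or> nests y x"
    using not_arc_iff_nests[of x y] assms(3) xy by simp
qed

text \<open>A chord that overlaps \<open>w\<close> but neither \<open>e\<close> nor
  \<open>e'\<close> has its ends in the gaps between corresponding ends of these chords. Each gap
  lies in one block, so the chord has the kind of \<open>w\<close> or both ends in the same
  block.\<close>

lemma not_arc_if_between:
  assumes w: "w \<in> pverts G" and v: "v \<in> pverts G" "kind v \<noteq> kind w"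
    and e: "nests e w" "(e, v) \<notin> parcs G" "e \<in> pverts G"
    and e': "nests w e'" "(e', v) \<notin> parcs G" "e' \<in> pverts G"
  shows "(w, v) \<notin> parcs G"
proof
  assume "(w, v) \<in> parcs G"
  then have ov: "overlap (lo w) (hi w) (lo v) (hi v)" by (simp add: arcs_iff)
  have no: "\<not> overlap (lo e) (hi e) (lo v) (hi v)" "\<not> overlap (lo e') (hi e') (lo v) (hi v)"
    using e e' v by (auto simp: arcs_iff)
  have ord: "lo e \<le> lo w" "lo w \<le> lo e'" "hi e' \<le> hi w" "hi w \<le> hi e"
    and cl: "cls (lo e) = cls (lo w)" "cls (lo e') = cls (lo w)"
      "cls (hi e') = cls (hi w)" "cls (hi e) = cls (hi w)"
    using e e' by (auto simp: nests_def kind_def)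
  have less: "lo e < hi e" "lo e' < hi e'" "lo w < hi w" "lo v < hi v"
    using w v e e' lo_less_hi by auto
  have same: "cls q = cls p" if "p \<le> q" "q \<le> p'" "cls p = cls p'" for p q p'
    using cls_mono[OF that(1)] cls_mono[OF that(2)] that(3) by simp
  from ov consider "lo w < lo v" "lo v < hi w" "hi w < hi v" | "lo v < lo w" "lo w < hi v" "hi v < hi w"
    by (auto simp: overlap_def)
  then show False
  proof cases
    case 1
    \<comment> \<open>As \<open>e\<close> contains \<open>w\<close> and does not overlap
      \<open>v\<close>, the right end of \<open>v\<close> lies in the gap from \<open>hi w\<close>
      to \<open>hi e\<close>.\<close>
    then have hv: "hi v \<le> hi e" using no(1) ord by (auto simp: overlap_def)
    then have chv: "cls (hi v) = cls (hi w)" using 1 cl by (intro same[of "hi w" _ "hi e"]) auto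
    have "\<not> (lo e' < lo v \<and> lo v < hi e')" using no(2) 1 ord by (auto simp: overlap_def)
    \<comment> \<open>The left end of \<open>v\<close> lies either in the gap between left ends,
      which gives \<open>v\<close> the kind of \<open>w\<close>, or in the gap between right ends,
      which puts both ends of \<open>v\<close> in one block.\<close>
    then consider "lo v \<le> lo e'" | "hi e' \<le> lo v" by linarith
    then show False
    proof cases
      case a: 1
      then have "cls (lo v) = cls (lo w)" using 1 cl by (intro same[of "lo w" _ "lo e'"]) auto
      then show False using chv v by (simp add: kind_def)
    next
      case 2
      then have "cls (lo v) = cls (hi e')"
        using 1 cl ord by (intro same[of "hi e'" _ "hi w"]) auto
      then show False using chv cl cls_ends[OF v(1)] by simp
    qed
  next
    case 2
    \<comment> \<open>The mirror image of the first case.\<close>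
    then have lv: "lo e \<le> lo v" using no(1) ord by (auto simp: overlap_def)
    then have clv: "cls (lo v) = cls (lo e)" using 2 cl by (intro same[of "lo e" _ "lo w"]) auto
    have "\<not> (lo e' < hi v \<and> hi v < hi e')" using no(2) 2 ord by (auto simp: overlap_def)
    then consider "hi v \<le> lo e'" | "hi e' \<le> hi v" by linarith
    then show False
    proof cases
      case 1
      then have "cls (hi v) = cls (lo w)" using 2 cl by (intro same[of "lo w" _ "lo e'"]) auto
      then show False using clv cl cls_ends[OF v(1)] by simp
    next
      case a: 2
      then have "cls (hi v) = cls (hi e')"
        using 2 cl ord by (intro same[of "hi e'" _ "hi w"]) auto
      then show False using clv cl v by (simp add: kind_def)
    qed
  qed
qed

text \<open>Every chord of \<open>C\<close> lies between two members of \<open>E\<close>, which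
  cross nothing in \<open>I\<close>; by \<open>not_arc_if_between\<close> it crosses no member of
  \<open>I\<close> of another kind.\<close>

lemma exchange:
  assumes I: "independent_set G I" and E: "E \<subseteq> I" and C: "C \<subseteq> sandwiched E" "nested C"
    and \<tau>: "\<And>x. x \<in> C \<Longrightarrow> kind x = \<tau>"
  shows "independent_set G ({v \<in> I. kind v \<noteq> \<tau>} \<union> C)"
proof -
  have IV: "I \<subseteq> pverts G" and CV: "C \<subseteq> pverts G"
    using I C by (auto simp: independent_set_def sandwiched_def)
  have sym: "(u, v) \<in> parcs G \<longleftrightarrow> (v, u) \<in> parcs G" for u v
    by (auto simp: arcs_iff overlap_commute)
  have II: "(u, v) \<notin> parcs G" if "u \<in> I" "v \<in> I" for u v
    using I that by (auto simp: independent_set_def)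
  have CC: "(u, v) \<notin> parcs G" if "u \<in> C" "v \<in> C" for u v
    using not_arc_iff_nests[of u v] that CV C(2) \<tau> by (auto simp: nested_def)
  have CI: "(w, v) \<notin> parcs G" if w: "w \<in> C" and v: "v \<in> I" "kind v \<noteq> \<tau>" for w v
  proof -
    obtain e e' where e: "e \<in> E" "e' \<in> E" "nests e w" "nests w e'"
      using C w by (auto simp: sandwiched_def)
    then show ?thesis
      using w v IV CV E II[of _ v] \<tau>[OF w] by (intro not_arc_if_between[of w v e e']) auto
  qed
  show ?thesis unfolding independent_set_def using IV CV II CC CI sym by blast
qed

section \<open>Mirsky depth and levels\<close>

lemma finite_sandwiched: "finite (sandwiched E)"
  using finite_verts by (auto simp: sandwiched_def)

lemma finite_chains: "finite {C. C \<subseteq> sandwiched E \<and> nested C \<and> (\<forall>x\<in>C. nests x w)}"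
  by (rule finite_subset[of _ "Pow (sandwiched E)"]) (auto simp: finite_sandwiched)

lemma card_le_depth:
  assumes "C \<subseteq> sandwiched E" "nested C" "\<And>x. x \<in> C \<Longrightarrow> nests x w"
  shows "card C \<le> depth E w"
  unfolding depth_def using assms finite_chains by (intro Max_ge) auto

lemma depth_chain:
  obtains C where "C \<subseteq> sandwiched E" "nested C" "\<forall>x\<in>C. nests x w" "card C = depth E w"
proof -
  have "depth E w \<in> card ` {C. C \<subseteq> sandwiched E \<and> nested C \<and> (\<forall>x\<in>C. nests x w)}"
    unfolding depth_def using finite_chains
    by (intro Max_in finite_imageI) (auto intro: exI[of _ "{}"] simp: nested_def)
  then show thesis using that by auto
qed

lemma depth_pos: "w \<in> sandwiched E \<Longrightarrow> 1 \<le> depth E w"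
  using card_le_depth[of "{w}" E w] by (auto simp: nested_def nests_refl)

text \<open>A longest chain around \<open>u\<close> extends by \<open>w\<close>, which is new by
  antisymmetry.\<close>

lemma depth_strict_mono:
  assumes "u \<in> sandwiched E" "w \<in> sandwiched E" "nests u w" "u \<noteq> w"
  shows "depth E u < depth E w"
proof -
  obtain C where C: "C \<subseteq> sandwiched E" "nested C" "\<forall>x\<in>C. nests x u" "card C = depth E u"
    using depth_chain[of E u] .
  have below: "nests x w" if "x \<in> C" for x using C(3) that assms(3) nests_trans by blast
  have "w \<notin> C"
    using C(3) nests_antisym[of u w] assms by (auto simp: sandwiched_def)
  moreover have "card (insert w C) \<le> depth E w"
    using C(1,2) assms(2) below
    by (intro card_le_depth) (auto simp: nested_def nests_refl)
  moreover have "finite C" using C(1) finite_sandwiched by (rule finite_subset)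
  ultimately show ?thesis using C(4) by simp
qed

text \<open>Mirsky's decomposition into levels, with the exchange argument bounding the depth by the
  number of members of the maximum independent set.\<close>

lemma level_maximum_independent_set:
  assumes I: "maximum_independent_set G I" and E: "E \<subseteq> I" "I \<subseteq> sandwiched E"
  shows "inj_on (level E) I" and "level E ` sandwiched E = level E ` I"
proof -
  have ind: "independent_set G I" and card_I: "card I = independence_number G"
    using I by (auto simp: maximum_independent_set_def)
  have IV: "I \<subseteq> pverts G" using ind by (simp add: independent_set_def)
  then have finI: "finite I" using finite_verts by (rule finite_subset)
  show inj: "inj_on (level E) I"
  proof (rule inj_onI)
    fix u w assume uw: "u \<in> I" "w \<in> I" "level E u = level E w"
    then have "nests u w \<or> nests w u"
      using not_arc_iff_nests[of u w] ind IV by (auto simp: level_def independent_set_def)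
    then show "u = w"
      using depth_strict_mono[of u E w] depth_strict_mono[of w E u] uw E(2)
      by (auto simp: level_def)
  qed
  have "level E w \<in> level E ` I" if w: "w \<in> sandwiched E" for w
  proof -
    let ?J = "{v \<in> I. kind v = kind w}"
    \<comment> \<open>Exchanging \<open>?J\<close> for a longest chain around \<open>x\<close> keeps
      the set independent, so maximality of \<open>I\<close> bounds the chain by
      \<open>?J\<close>.\<close>
    have le: "depth E x \<le> card ?J" if x: "x \<in> sandwiched E" "kind x = kind w" for x
    proof -
      obtain C where C: "C \<subseteq> sandwiched E" "nested C" "\<forall>x'\<in>C. nests x' x" "card C = depth E x"
        using depth_chain[of E x] .
      have \<tau>: "kind y = kind w" if "y \<in> C" for y using nests_kind[of y x] C(3) that x by simp
      have finC: "finite C" using C(1) finite_sandwiched by (rule finite_subset)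
      have "card ({v \<in> I. kind v \<noteq> kind w} \<union> C) \<le> card I"
        unfolding card_I using exchange[OF ind E(1) C(1,2) \<tau>]
        by (intro card_le_independence_number finite_verts) auto
      also have "card ({v \<in> I. kind v \<noteq> kind w} \<union> C) = card {v \<in> I. kind v \<noteq> kind w} + card C"
        using finI finC \<tau> by (intro card_Un_disjoint) auto
      also have "card I = card {v \<in> I. kind v \<noteq> kind w} + card ?J"
        using finI by (subst card_Un_disjoint[symmetric]) (auto intro: arg_cong[of _ _ card])
      finally show ?thesis using C(4) by simp
    qed
    \<comment> \<open>Injective depths between 1 and \<open>card ?J\<close> leave no value out, so
      \<open>?J\<close> meets every level of its kind.\<close>
    have "inj_on (depth E) ?J"
      using inj by (auto simp: inj_on_def level_def)
    then have "card (depth E ` ?J) = card {1..card ?J}" by (simp add: card_image)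
    moreover have "depth E ` ?J \<subseteq> {1..card ?J}" using le depth_pos E(2) by auto
    ultimately have "depth E ` ?J = {1..card ?J}" by (intro card_subset_eq) auto
    moreover have "depth E w \<in> {1..card ?J}" using le[OF w] depth_pos[OF w] by simp
    ultimately have "depth E w \<in> depth E ` ?J" by simp
    then obtain v where "v \<in> ?J" "depth E v = depth E w" by fastforce
    then show ?thesis by (intro image_eqI[of _ _ v]) (auto simp: level_def)
  qed
  then show "level E ` sandwiched E = level E ` I" using E(2) by auto
qed

text \<open>In each kind the members of \<open>I\<close> form a chain, and its longest and shortest
  intervals are the outermost and innermost ones.\<close>

lemma independent_set_subset_sandwiched:
  assumes I: "independent_set G I"
  obtains E where "E \<subseteq> I" "card E \<le> 2 * card (kind ` I)" "I \<subseteq> sandwiched E"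
proof -
  have IV: "I \<subseteq> pverts G" using I by (simp add: independent_set_def)
  then have finI: "finite I" using finite_verts by (rule finite_subset)
  have ext: "\<exists>u v. u \<in> I \<and> v \<in> I \<and> (\<forall>w\<in>I. kind w = \<tau> \<longrightarrow> nests u w \<and> nests w v)"
    if \<tau>: "\<tau> \<in> kind ` I" for \<tau>
  proof -
    let ?J = "{v \<in> I. kind v = \<tau>}"
    have J: "finite ?J" "?J \<noteq> {}" using finI \<tau> by auto
    have nJ: "nested ?J" using I by (rule nested_if_independent[of I _ \<tau>]) auto
    define len where "len v = hi v - lo v" for v
    have "Max (len ` ?J) \<in> len ` ?J" "Min (len ` ?J) \<in> len ` ?J"
      using J by (intro Max_in Min_in finite_imageI; simp)+
    then obtain u v where uv: "u \<in> ?J" "len u = Max (len ` ?J)" "v \<in> ?J" "len v = Min (len ` ?J)"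
      by (auto simp: image_iff)
    then have bounds: "len w \<le> len u" "len v \<le> len w" if "w \<in> ?J" for w
      using J(1) that by simp_all
    \<comment> \<open>If the containment goes the other way, the lengths agree and so do the
      ends.\<close>
    have "nests x y" if "x \<in> ?J" "y \<in> ?J" "len y \<le> len x" for x y
    proof -
      have "nests x y \<or> nests y x" using nJ that(1,2) unfolding nested_def by blast
      then show ?thesis using that(3) by (auto simp: nests_def len_def)
    qed
    then show ?thesis using uv(1,3) bounds by (intro exI[of _ u] exI[of _ v]) auto
  qed
  then obtain f g where fg: "\<And>\<tau>. \<tau> \<in> kind ` I \<Longrightarrow>
      f \<tau> \<in> I \<and> g \<tau> \<in> I \<and> (\<forall>w\<in>I. kind w = \<tau> \<longrightarrow> nests (f \<tau>) w \<and> nests w (g \<tau>))"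
    by metis
  let ?E = "f ` kind ` I \<union> g ` kind ` I"
  show thesis
  proof (rule that[of ?E])
    show "?E \<subseteq> I" using fg by auto
    have "card ?E \<le> card (f ` kind ` I) + card (g ` kind ` I)" by (rule card_Un_le)
    also have "\<dots> \<le> card (kind ` I) + card (kind ` I)"
      using finI by (intro add_mono card_image_le) auto
    finally show "card ?E \<le> 2 * card (kind ` I)" by simp
    show "I \<subseteq> sandwiched ?E" using fg IV unfolding sandwiched_def by blast
  qed
qed


text \<open>There are as many levels as members of \<open>I\<close>. They are disjoint, so those
  with at least \<open>Suc b\<close> elements number at most \<open>card (pverts G) / Suc b\<close>,
  which by hypothesis is at most half of them.\<close>

lemma many_small_levels:
  assumes I: "maximum_independent_set G I" and E: "E \<subseteq> I" "I \<subseteq> sandwiched E"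
    and b: "2 * card (pverts G) \<le> independence_number G * Suc b"
  shows "independence_number G
    \<le> 2 * card {p \<in> level E ` sandwiched E. card {w \<in> sandwiched E. level E w = p} \<le> b}"
proof -
  let ?P = "level E ` sandwiched E" and ?F = "\<lambda>p. {w \<in> sandwiched E. level E w = p}"
  let ?S = "{p \<in> ?P. card (?F p) \<le> b}" and ?B = "{p \<in> ?P. \<not> card (?F p) \<le> b}"
  have fin: "finite ?P" using finite_sandwiched by simp
  have "card ?P = card I"
    using level_maximum_independent_set[OF I E] by (simp add: card_image)
  then have P: "card ?P = independence_number G"
    using I by (simp add: maximum_independent_set_def)
  have "card ?P = card (?S \<union> ?B)" by (rule arg_cong[of _ _ card]) auto
  also have "\<dots> = card ?S + card ?B" using fin by (intro card_Un_disjoint) auto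
  finally have sum: "independence_number G = card ?S + card ?B" using P by simp
  have "card ?B * Suc b = (\<Sum>p\<in>?B. Suc b)" by simp
  also have "\<dots> \<le> (\<Sum>p\<in>?B. card (?F p))" by (rule sum_mono) auto
  also have "\<dots> = card (\<Union>p\<in>?B. ?F p)"
  proof (rule card_UN_disjoint[symmetric])
    show "finite ?B" "\<forall>p\<in>?B. finite (?F p)" using fin finite_sandwiched by simp_all
    show "\<forall>p\<in>?B. \<forall>q\<in>?B. p \<noteq> q \<longrightarrow> ?F p \<inter> ?F q = {}" by blast
  qed
  also have "\<dots> \<le> card (pverts G)"
    using finite_verts by (intro card_mono) (auto simp: sandwiched_def)
  finally have "(2 * card ?B) * Suc b \<le> independence_number G * Suc b" using b by simp
  then have "2 * card ?B \<le> independence_number G" by (simp only: mult_le_cancel2)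
  then show ?thesis using sum by simp
qed

text \<open>The random colouring is applied to the small levels of every possible \<open>E\<close>.
  A set containing one level for each \<open>E\<close> hits every maximum independent set, since
  such a set meets all levels of its own \<open>E\<close>.\<close>

lemma small_hitting_set:
  assumes \<alpha>: "independence_number G > 0" and s: "s > 0"
    and K: "card (kind ` pverts G) \<le> K"
    and b: "2 * card (pverts G) \<le> independence_number G * Suc b"
    and bound: "real (card (pverts G) ^ (2 * K)) * real s *
      exp (- (real (independence_number G) / 2 / real s ^ b)) < 1"
  obtains R where "hitting_set G R" "s * card R \<le> card (pverts G)"
proof -
  let ?F = "\<lambda>E p. {w \<in> sandwiched E. level E w = p}"
  \<comment> \<open>Lists of fixed length encode the sets \<open>E\<close>, two chords for each of
    at most \<open>K\<close> kinds, which makes the count a power of \<open>card (pverts G)\<close>.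
    Only lists realised by some maximum independent set are kept, so that
    \<open>many_small_levels\<close> applies.\<close>
  define X where "X = {xs. set xs \<subseteq> pverts G \<and> length xs = 2 * K \<and>
    (\<exists>I. maximum_independent_set G I \<and> set xs \<subseteq> I \<and> I \<subseteq> sandwiched (set xs))}"
  define P where "P xs = {p \<in> level (set xs) ` sandwiched (set xs). card (?F (set xs) p) \<le> b}" for xs
  define \<L> where "\<L> xs = ?F (set xs) ` P xs" for xs
  have lists: "finite {xs. set xs \<subseteq> pverts G \<and> length xs = 2 * K}"
    using finite_verts by (rule finite_lists_length_eq)
  have X_sub: "X \<subseteq> {xs. set xs \<subseteq> pverts G \<and> length xs = 2 * K}" by (auto simp: X_def)
  have finX: "finite X" using X_sub lists by (rule finite_subset)
  have "card X \<le> card (pverts G) ^ (2 * K)"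
    using card_mono[OF lists X_sub] card_lists_length_eq[OF finite_verts, of "2 * K"] by simp
  then have "real (card X) \<le> real (card (pverts G) ^ (2 * K))" by (rule of_nat_mono)
  then have "real (card X) * real s * exp (- (real (independence_number G) / 2 / real s ^ b))
      \<le> real (card (pverts G) ^ (2 * K)) * real s * exp (- (real (independence_number G) / 2 / real s ^ b))"
    by (intro mult_right_mono) auto
  then have bd: "real (card X) * real s * exp (- (real (independence_number G) / 2 / real s ^ b)) < 1"
    using bound by linarith
  have many: "real (independence_number G) / 2 \<le> real (card (\<L> xs))" if xs: "xs \<in> X" for xs
  proof -
    have "inj_on (?F (set xs)) (P xs)"
    proof (rule inj_onI)
      fix p q assume pq: "p \<in> P xs" "q \<in> P xs" "?F (set xs) p = ?F (set xs) q"
      then obtain w where "w \<in> ?F (set xs) p" by (auto simp: P_def)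
      moreover from this have "w \<in> ?F (set xs) q" using pq(3) by simp
      ultimately show "p = q" by simp
    qed
    then have "card (\<L> xs) = card (P xs)" by (simp add: \<L>_def card_image)
    moreover obtain I where "maximum_independent_set G I" "set xs \<subseteq> I" "I \<subseteq> sandwiched (set xs)"
      using xs by (auto simp: X_def)
    then have "independence_number G \<le> 2 * card (P xs)"
      unfolding P_def using b by (rule many_small_levels)
    ultimately show ?thesis by linarith
  qed
  obtain R where R: "R \<subseteq> pverts G" "s * card R \<le> card (pverts G)"
      "\<forall>xs\<in>X. \<exists>L\<in>\<L> xs. L \<subseteq> R"
  proof (rule small_set_containing_members[OF finite_verts finX s _ _ _ many bd])
    show "disjoint (\<L> xs)" for xs by (auto simp: \<L>_def disjoint_def)
    show "\<Union>(\<L> xs) \<subseteq> pverts G" for xs by (auto simp: \<L>_def sandwiched_def)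
    show "card L \<le> b" if "L \<in> \<L> xs" for xs L using that by (auto simp: \<L>_def P_def)
  qed
  have "R \<inter> I \<noteq> {}" if I: "maximum_independent_set G I" for I
  proof -
    have ind: "independent_set G I" and card_I: "card I = independence_number G"
      using I by (auto simp: maximum_independent_set_def)
    have IV: "I \<subseteq> pverts G" using ind by (simp add: independent_set_def)
    have finI: "finite I" using IV finite_verts by (rule finite_subset)
    obtain E where E: "E \<subseteq> I" "card E \<le> 2 * card (kind ` I)" "I \<subseteq> sandwiched E"
      using independent_set_subset_sandwiched[OF ind] .
    have "I \<noteq> {}" using card_I \<alpha> by auto
    then have "E \<noteq> {}" using E(3) by (auto simp: sandwiched_def)
    have "card (kind ` I) \<le> card (kind ` pverts G)"
      using IV finite_verts by (intro card_mono) auto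
    then have cE: "card E \<le> 2 * K" using E(2) K by linarith
    obtain ys where ys: "set ys = E" "distinct ys"
      using finite_distinct_list finite_subset[OF E(1) finI] by blast
    \<comment> \<open>Repeating the first element pads the list to length \<open>2 * K\<close>
      without changing its set; this uses that \<open>E\<close> is nonempty.\<close>
    define xs where "xs = ys @ replicate (2 * K - length ys) (hd ys)"
    have "ys \<noteq> []" using ys \<open>E \<noteq> {}\<close> by auto
    then have xs: "set xs = E" using ys(1) by (auto simp: xs_def)
    have "length ys = card E" using ys distinct_card by force
    then have "length xs = 2 * K" using cE by (simp add: xs_def)
    then have "xs \<in> X" using xs I E IV by (auto simp: X_def)
    then obtain L where L: "L \<in> \<L> xs" "L \<subseteq> R" using R(3) by blast
    then obtain p where p: "p \<in> level E ` sandwiched E" "L = ?F E p"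
      by (auto simp: \<L>_def P_def xs)
    obtain v where "v \<in> I" "level E v = p"
      using p(1) level_maximum_independent_set(2)[OF I E(1,3)] by auto
    then have "v \<in> L" using p(2) E(3) by auto
    then show ?thesis using L(2) \<open>v \<in> I\<close> by auto
  qed
  then show thesis using R by (intro that[of R]) (auto simp: hitting_set_def)
qed

end

section \<open>Choice of the parameters\<close>

lemma (in overlap_graph) hitting_number_le_max:
  assumes \<alpha>: "independence_number G > 0" and s: "s > 0" and m: "m > 0"
    and b: "2 * card (pverts G) \<le> independence_number G * Suc b"
    and bound: "real (card (pverts G) ^ (2 * (2 * card (pverts G) div m + 1)\<^sup>2)) * real s *
      exp (- (real (independence_number G) / 2 / real s ^ b)) < 1"
  shows "hitting_number G \<le> m \<or> s * hitting_number G \<le> card (pverts G)"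
proof (cases "\<exists>v\<in>pverts G. end_count (lo v) div m = end_count (hi v) div m")
  case True
  then obtain v where v: "v \<in> pverts G" "end_count (lo v) div m = end_count (hi v) div m" by blast
  \<comment> \<open>Equal quotients cancel, leaving a difference of remainders.\<close>
  have "end_count (hi v) - end_count (lo v) \<le> end_count (hi v) mod m"
    using div_mult_mod_eq[of "end_count (hi v)" m] div_mult_mod_eq[of "end_count (lo v)" m]
    unfolding v(2) by linarith
  also have "\<dots> \<le> m" using m by (simp add: less_imp_le)
  finally show ?thesis using hitting_number_le_end_count_diff[OF v(1)] by linarith
next
  case False
  interpret classified_overlap_graph G lo hi "\<lambda>p. end_count p div m"
    using False by unfold_locales (auto intro: div_le_mono end_count_mono)
  \<comment> \<open>A bound on the number of blocks, which are numbered from 0; a kind is a pair of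
    blocks.\<close>
  let ?k = "2 * card (pverts G) div m + 1"
  have "kind ` pverts G \<subseteq> {..<?k} \<times> {..<?k}"
    using div_le_mono[OF end_count_le, of _ m] by (auto simp: kind_def less_Suc_eq_le)
  then have "card (kind ` pverts G) \<le> card ({..<?k} \<times> {..<?k})"
    by (intro card_mono) auto
  then have "card (kind ` pverts G) \<le> ?k\<^sup>2"
    by (simp add: card_cartesian_product power2_eq_square)
  then obtain R where R: "hitting_set G R" "s * card R \<le> card (pverts G)"
    using small_hitting_set[OF \<alpha> s _ b bound] by blast
  have "s * hitting_number G \<le> s * card R"
    using hitting_number_le[OF finite_verts R(1)] by simp
  then show ?thesis using R(2) by linarith
qed

text \<open>The choice is \<open>n / log 2 n\<close> for \<open>m\<close> and \<open>log 2 n\<close>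
  for \<open>s\<close>, both rounded up. The count of sets \<open>E\<close> then has a
  polylogarithmic logarithm, which is beaten by \<open>n\<close> divided by a power of
  \<open>log 2 n\<close>.\<close>

lemma eventually_parameters:
  fixes c :: real and b :: nat
  assumes "c > 0"
  shows "\<forall>\<^sub>F n in sequentially. \<exists>m s :: nat. m > 0 \<and> s > 0 \<and>
    real m \<le> 4 * real n * log 2 (log 2 (real n)) / log 2 (real n) \<and>
    real n / real s \<le> 4 * real n * log 2 (log 2 (real n)) / log 2 (real n) \<and>
    real (n ^ (2 * (2 * n div m + 1)\<^sup>2)) * real s * exp (- (c * real n / 2 / real s ^ b)) < 1"
proof -
  \<comment> \<open>The logarithm of the union bound, with \<open>2 * log 2 x + 1\<close> for the
    number of blocks and \<open>log 2 x + 1\<close> for the number of colours.\<close>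
  have "\<forall>\<^sub>F x::real in at_top. 2 * (2 * log 2 x + 1)\<^sup>2 * ln x + ln (log 2 x + 1)
      < c * x / 2 / (log 2 x + 1) ^ b"
    using assms by real_asymp
  \<comment> \<open>The summand 1 pays for rounding \<open>m\<close> up; the factor
    \<open>log 2 (log 2 x)\<close> leaves ample room.\<close>
  moreover have "\<forall>\<^sub>F x::real in at_top. 1 + x / log 2 x \<le> 4 * x * log 2 (log 2 x) / log 2 x"
    by real_asymp
  ultimately have "\<forall>\<^sub>F x::real in at_top. x \<ge> 2 \<and>
      2 * (2 * log 2 x + 1)\<^sup>2 * ln x + ln (log 2 x + 1) < c * x / 2 / (log 2 x + 1) ^ b \<and>
      1 + x / log 2 x \<le> 4 * x * log 2 (log 2 x) / log 2 x"
    using eventually_ge_at_top[of "2::real"] by eventually_elim auto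
  then have "\<forall>\<^sub>F n in sequentially. real n \<ge> 2 \<and>
      2 * (2 * log 2 (real n) + 1)\<^sup>2 * ln (real n) + ln (log 2 (real n) + 1)
        < c * real n / 2 / (log 2 (real n) + 1) ^ b \<and>
      1 + real n / log 2 (real n) \<le> 4 * real n * log 2 (log 2 (real n)) / log 2 (real n)"
    by (rule filterlim_real_sequentially[THEN filterlim_iff[THEN iffD1], rule_format])
  then show ?thesis
  proof eventually_elim
    case (elim n)
    define l where "l = log 2 (real n)"
    have l: "l \<ge> 1" using elim by (simp add: l_def le_log_iff)
    define m where "m = nat \<lceil>real n / l\<rceil>"
    define s where "s = nat \<lceil>l\<rceil>"
    have m: "real n / l \<le> real m" "real m \<le> 1 + real n / l"
      using l unfolding m_def by (simp_all add: of_nat_ceiling) linarith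
    have s: "l \<le> real s" "real s \<le> l + 1"
      using l unfolding s_def by linarith+
    have m0: "m > 0" using m(1) l elim by (smt (verit) divide_pos_pos gr0I of_nat_0)
    have s0: "s > 0" using s(1) l by linarith
    have "real (2 * n div m) \<le> real (2 * n) / real m" by (rule of_nat_div_le_of_nat)
    also have "\<dots> \<le> 2 * l"
      using m(1) l m0 by (simp add: field_simps)
    finally have k: "real (2 * n div m + 1) \<le> 2 * l + 1" by simp
    let ?K = "2 * (2 * n div m + 1)\<^sup>2"
    have "real ?K \<le> 2 * (2 * l + 1)\<^sup>2"
      using power_mono[OF k, of 2] by simp
    then have "real ?K * ln (real n) \<le> 2 * (2 * l + 1)\<^sup>2 * ln (real n)"
      using elim by (intro mult_right_mono) auto
    moreover have "ln (real s) \<le> ln (l + 1)" using s s0 by simp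
    moreover have "c * real n / 2 / (l + 1) ^ b \<le> c * real n / 2 / real s ^ b"
      using assms s s0 by (intro divide_left_mono power_mono mult_pos_pos) auto
    ultimately have lt: "real ?K * ln (real n) + ln (real s) - c * real n / 2 / real s ^ b < 0"
      using elim unfolding l_def by linarith
    have "real (n ^ ?K) * real s * exp (- (c * real n / 2 / real s ^ b))
        = exp (real ?K * ln (real n)) * exp (ln (real s)) * exp (- (c * real n / 2 / real s ^ b))"
      using s0 elim by (simp only: exp_of_nat_mult) simp
    also have "\<dots> = exp (real ?K * ln (real n) + ln (real s) - c * real n / 2 / real s ^ b)"
      by (simp only: exp_add[symmetric]) simp
    also have "\<dots> < 1" using lt by (simp only: exp_less_one_iff)
    finally have 1: "real (n ^ ?K) * real s * exp (- (c * real n / 2 / real s ^ b)) < 1" .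
    have 2: "real m \<le> 4 * real n * log 2 (log 2 (real n)) / log 2 (real n)"
      using m(2) elim unfolding l_def by linarith
    have "real n / real s \<le> real n / l" using s l by (intro divide_left_mono) auto
    then have 3: "real n / real s \<le> 4 * real n * log 2 (log 2 (real n)) / log 2 (real n)"
      using elim unfolding l_def by linarith
    show ?case using 1 2 3 m0 s0 by blast
  qed
qed

theorem theorem4p1:
  fixes c :: real
  assumes "c > 0"
  shows "\<exists>N::nat. \<forall>n\<ge>N. \<forall>G. circle_graph G \<and> card (pverts G) = n \<and>
           real (independence_number G) = c * real n \<longrightarrow>
           real (hitting_number G) \<le> 4 * real n * log 2 (log 2 (real n)) / log 2 (real n)"
proof -
  \<comment> \<open>Levels larger than \<open>b\<close> have more than \<open>2 / c\<close>
    elements, so at most half of the \<open>c * n\<close> levels can be that large.\<close>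
  define b where "b = nat \<lfloor>2 / c\<rfloor>"
  have "2 / c \<le> real (Suc b)" unfolding b_def by linarith
  then have b: "2 \<le> c * real (Suc b)" using assms by (simp add: field_simps)
  obtain N where N: "\<And>n. n \<ge> N \<Longrightarrow> \<exists>m s :: nat. m > 0 \<and> s > 0 \<and>
    real m \<le> 4 * real n * log 2 (log 2 (real n)) / log 2 (real n) \<and>
    real n / real s \<le> 4 * real n * log 2 (log 2 (real n)) / log 2 (real n) \<and>
    real (n ^ (2 * (2 * n div m + 1)\<^sup>2)) * real s * exp (- (c * real n / 2 / real s ^ b)) < 1"
    using eventually_parameters[OF assms, of b] unfolding eventually_sequentially by blast
  \<comment> \<open>The bound 1 makes the graph nonempty and hence its independence number
    positive.\<close>
  show ?thesis
  proof (intro exI[of _ "max N 1"] allI impI, elim conjE)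
    fix n and G :: "complex set pair_pre_digraph"
    assume n: "n \<ge> max N 1" and G: "circle_graph G" "card (pverts G) = n"
      and \<alpha>: "real (independence_number G) = c * real n"
    obtain lo hi where "overlap_graph G lo hi" using circle_graph_imp_overlap_graph[OF G(1)] .
    then interpret overlap_graph G lo hi .
    obtain m s :: nat where ms: "m > 0" "s > 0"
      "real m \<le> 4 * real n * log 2 (log 2 (real n)) / log 2 (real n)"
      "real n / real s \<le> 4 * real n * log 2 (log 2 (real n)) / log 2 (real n)"
      "real (n ^ (2 * (2 * n div m + 1)\<^sup>2)) * real s * exp (- (c * real n / 2 / real s ^ b)) < 1"
      using N n by (metis max.bounded_iff)
    have "real (independence_number G) > 0" using \<alpha> assms n by simp
    then have pos: "independence_number G > 0" by simp
    have "2 * real n \<le> (c * real (Suc b)) * real n" using b by (intro mult_right_mono) auto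
    also have "\<dots> = real (independence_number G * Suc b)" by (simp only: of_nat_mult \<alpha> mult_ac)
    finally have "2 * card (pverts G) \<le> independence_number G * Suc b"
      using G(2) by linarith
    then have "hitting_number G \<le> m \<or> s * hitting_number G \<le> n"
      using hitting_number_le_max[OF pos ms(2,1), of b] ms(5) \<alpha> G(2) by simp
    then show "real (hitting_number G) \<le> 4 * real n * log 2 (log 2 (real n)) / log 2 (real n)"
    proof
      assume "hitting_number G \<le> m"
      then show ?thesis using ms(3) by linarith
    next
      assume "s * hitting_number G \<le> n"
      then have "real s * real (hitting_number G) \<le> real n" by (simp flip: of_nat_mult)
      then have "real (hitting_number G) \<le> real n / real s" using ms(2) by (simp add: field_simps)
      then show ?thesis using ms(4) by linarith
    qed
  qed
qed

end
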